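(* Fix arbitrary $\lambda>0$ and $\rho>0$. Consider an arbitrary $\overline{x}\in\mathbb{R}^p$ with $0\in\partial\Theta_{\lambda,\rho}(\overline{x})$ and $|\overline{x}_{\rm nz}|>\frac{2a}{\rho(a+1)}$. Then, for any $0\ne\zeta\in\mathbb{R}^p$, it holds that $d^2\Theta_{\lambda,\rho}(\overline{x}|0)(\zeta)>0$, and consequently $\overline{x}$ is a local optimal solution of the problem $\min_{x\in\mathbb{R}^p}\Theta_{\lambda,\rho}(x)$.
   Context: Data: $f:\mathbb{R}^n\to\mathbb{R}_+$ is a piecewise linear-quadratic (nonsmooth) convex function, $A\in\mathbb{R}^{n\times p}$, $b\in\mathbb{R}^n$, $\Omega\subseteq\mathbb{R}^p$ is a nonempty polyhedral (convex) set, $\mu>0$, and $F_\mu(x):=f(Ax-b)+\frac{\mu}{2}\|x\|^2$. $\delta_\Omega$ is the indicator function of $\Omega$. Surrogate: fix $a>1$, let $\phi(t)=\frac{a-1}{a+1}t^2+\frac{2}{a+1}t$, $\psi(t)=\phi(t)$ for $t\in[0,1]$ and $\psi(t)=+\infty$ otherwise, and let $\psi^*$ be its conjugate, i.e. $\psi^*(s)=0$ if $s\le\frac{2}{a+1}$, $\psi^*(s)=\frac{((a+1)s-2)^2}{4(a^2-1)}$ if $\frac{2}{a+1}<s\le\frac{2a}{a+1}$, and $\psi^*(s)=s-1$ if $s>\frac{2a}{a+1}$. Then $$\Theta_{\lambda,\rho}(x):=F_\mu(x)+\delta_\Omega(x)+\lambda\|x\|_1-\lambda\rho^{-1}\sum_{i=1}^p\psi^*(\rho|x_i|).$$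 $\partial$ denotes the limiting subdifferential. The second subderivative of $h$ at $\overline{x}$ for $v$ and $\zeta$ is $$d^2h(\overline{x}|v)(\zeta):=\liminf_{\tau\downarrow0,\ \zeta'\to\zeta}\frac{h(\overline{x}+\tau\zeta')-h(\overline{x})-\tau\langle v,\zeta'\rangle}{\frac12\tau^2}.$$ For a vector $x$, $|x_{\rm nz}|$ denotes the smallest absolute value among the nonzero entries of $x$. *)

theory Defs
  imports "HOL-Analysis.Analysis"
begin

text \<open>Extended-real-valued functions have type \<open>'a \<Rightarrow> ereal\<close>; vectors in \<open>\<real>\<^sup>n\<close> and
  \<open>n \<times> p\<close> matrices have types \<open>real ^ 'n\<close> and \<open>real ^ 'p ^ 'n\<close>.\<close>

definition set_indicator :: "'a set \<Rightarrow> 'a \<Rightarrow> ereal" where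
  "set_indicator S x = (if x \<in> S then 0 else \<infinity>)"

definition fenchel_conjugate :: "(real \<Rightarrow> ereal) \<Rightarrow> real \<Rightarrow> ereal" where
  "fenchel_conjugate g s = (SUP t. ereal (s * t) - g t)"

text \<open>Rockafellar and Wets, Definition 10.20, for a finite-valued function: the domain,
  here the whole space, is a union of finitely many polyhedral sets, relative to each of which
  the function is quadratic (possibly affine).\<close>

definition piecewise_linear_quadratic :: "(real ^ 'n \<Rightarrow> real) \<Rightarrow> bool" where
  "piecewise_linear_quadratic f \<longleftrightarrow>
    (\<exists>\<C>. finite \<C> \<and> \<Union>\<C> = UNIV \<and>
      (\<forall>C\<in>\<C>. polyhedron C \<and>
        (\<exists>(Q :: real ^ 'n ^ 'n) (q :: real ^ 'n) (c :: real). transpose Q = Q \<and>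
          (\<forall>x\<in>C. f x = 1/2 * (x \<bullet> (Q *v x)) + q \<bullet> x + c))))"

text \<open>Both subdifferentials are empty at points where \<open>h\<close> is not finite.\<close>

definition regular_subdifferential :: "('a::euclidean_space \<Rightarrow> ereal) \<Rightarrow> 'a \<Rightarrow> 'a set" where
  "regular_subdifferential h x =
    {v. \<bar>h x\<bar> \<noteq> \<infinity> \<and>
        0 \<le> Liminf (at x) (\<lambda>z. (h z - h x - ereal (v \<bullet> (z - x))) / ereal (norm (z - x)))}"

definition limiting_subdifferential :: "('a::euclidean_space \<Rightarrow> ereal) \<Rightarrow> 'a \<Rightarrow> 'a set" where
  "limiting_subdifferential h x =
    {v. \<bar>h x\<bar> \<noteq> \<infinity> \<and>
        (\<exists>X V. X \<longlonglongrightarrow> x \<and> (\<lambda>k. h (X k)) \<longlonglongrightarrow> h x \<and>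
               (\<forall>k. V k \<in> regular_subdifferential h (X k)) \<and> V \<longlonglongrightarrow> v)}"

text \<open>Meaningful when \<open>h x\<close> is finite. The filter \<open>nhds \<zeta>\<close> does not exclude \<open>\<zeta>' = \<zeta>\<close>.\<close>

definition second_subderivative ::
    "('a::euclidean_space \<Rightarrow> ereal) \<Rightarrow> 'a \<Rightarrow> 'a \<Rightarrow> 'a \<Rightarrow> ereal" where
  "second_subderivative h x v \<zeta> =
    Liminf (at_right 0 \<times>\<^sub>F nhds \<zeta>)
      (\<lambda>(\<tau>, \<zeta>'). (h (x + \<tau> *\<^sub>R \<zeta>') - h x - ereal (\<tau> * (v \<bullet> \<zeta>'))) / ereal (1/2 * \<tau>\<^sup>2))"

definition local_minimizer :: "('a::topological_space \<Rightarrow> ereal) \<Rightarrow> 'a \<Rightarrow> bool" where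
  "local_minimizer h x \<longleftrightarrow> \<bar>h x\<bar> \<noteq> \<infinity> \<and> (\<forall>\<^sub>F y in nhds x. h x \<le> h y)"

definition l1_norm :: "real ^ 'n \<Rightarrow> real" where
  "l1_norm x = (\<Sum>i\<in>UNIV. \<bar>x $ i\<bar>)"

text \<open>The smallest absolute value among the nonzero entries; the infimum is a minimum unless
  \<open>x = 0\<close>, in which case it is \<open>\<infinity>\<close>.\<close>

definition min_abs_nonzero :: "real ^ 'n \<Rightarrow> ereal" where
  "min_abs_nonzero x = (INF i\<in>{i. x $ i \<noteq> 0}. ereal \<bar>x $ i\<bar>)"

definition phi :: "real \<Rightarrow> real \<Rightarrow> real" where
  "phi a t = (a - 1) / (a + 1) * t\<^sup>2 + 2 / (a + 1) * t"

definition psi :: "real \<Rightarrow> real \<Rightarrow> ereal" where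
  "psi a t = (if t \<in> {0..1} then ereal (phi a t) else \<infinity>)"

lemma fenchel_conjugate_psi:
  assumes "a > 1"
  shows "fenchel_conjugate (psi a) s = ereal
    (if s \<le> 2 / (a + 1) then 0
     else if s \<le> 2 * a / (a + 1) then ((a + 1) * s - 2)\<^sup>2 / (4 * (a\<^sup>2 - 1))
     else s - 1)"
    (is "_ = ereal ?c")
proof -
  define k where "k = (a - 1) / (a + 1)"
  define m where "m = 2 / (a + 1)"
  have k: "k > 0" using assms by (simp add: k_def)
  have a1: "a + 1 \<noteq> 0" using assms by linarith
  have ka: "(a + 1) * k = a - 1" and ma: "(a + 1) * m = 2"
    unfolding k_def m_def by (simp_all only: nonzero_mult_div_cancel_left[OF a1] times_divide_eq_right)
  have km: "k + m = 1"
  proof -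
    have "(a + 1) * (k + m) = (a + 1) * 1" unfolding distrib_left ka ma by simp
    then show ?thesis using a1 mult_left_cancel by blast
  qed
  have am: "2 * a / (a + 1) = m + 2 * k"
  proof -
    have "(m + 2 * k) * (a + 1) = (a + 1) * m + 2 * ((a + 1) * k)" by algebra
    also have "\<dots> = 2 * a" unfolding ka ma by simp
    finally show ?thesis using a1 by (metis nonzero_mult_div_cancel_right)
  qed
  have mid: "((a + 1) * s - 2)\<^sup>2 / (4 * (a\<^sup>2 - 1)) = (s - m)\<^sup>2 / (4 * k)"
  proof -
    have 1: "(a + 1) * s - 2 = (a + 1) * (s - m)" unfolding right_diff_distrib ma ..
    have "(a + 1)\<^sup>2 * (4 * k) = 4 * (a + 1) * ((a + 1) * k)" by algebra
    then have 2: "4 * (a\<^sup>2 - 1) = (a + 1)\<^sup>2 * (4 * k)"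
      unfolding ka by (simp add: power2_eq_square algebra_simps)
    have "(a + 1)\<^sup>2 \<noteq> 0" using a1 by simp
    then show ?thesis unfolding 1 2 power_mult_distrib by (rule mult_divide_mult_cancel_left)
  qed
  have c: "?c = (if s \<le> m then 0 else if s \<le> m + 2 * k then (s - m)\<^sup>2 / (4 * k) else s - 1)"
    unfolding mid am m_def ..
  have ph: "phi a t = k * t\<^sup>2 + m * t" for t by (simp add: phi_def k_def m_def)
  have ub: "s * t - phi a t \<le> ?c" if t: "0 \<le> t" "t \<le> 1" for t
  proof -
    have e: "s * t - phi a t = (s - m) * t - k * t\<^sup>2" by (simp add: ph algebra_simps)
    consider "s \<le> m" | "m < s" "s \<le> m + 2 * k" | "s > m + 2 * k" by linarith
    then show ?thesis
    proof cases
      case 1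
      have "(s - m) * t \<le> 0" using 1 t by (simp add: mult_nonpos_nonneg)
      moreover have "k * t\<^sup>2 \<ge> 0" using k by simp
      ultimately show ?thesis using 1 unfolding c e by simp
    next
      case 2
      have "0 \<le> (s - m - 2 * k * t)\<^sup>2" by simp
      also have "\<dots> = (s - m)\<^sup>2 - 4 * k * ((s - m) * t - k * t\<^sup>2)"
        by (simp add: power2_eq_square algebra_simps)
      finally have "(s - m) * t - k * t\<^sup>2 \<le> (s - m)\<^sup>2 / (4 * k)"
        using k by (simp add: field_simps)
      then show ?thesis using 2 unfolding c e by simp
    next
      case 3
      have "k * (1 + t) \<le> k * 2" using k t by (intro mult_left_mono) auto
      then have "0 \<le> (1 - t) * (s - m - k * (1 + t))"
        using 3 t by (intro mult_nonneg_nonneg) auto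
      also have "\<dots> = s - m - k - ((s - m) * t - k * t\<^sup>2)"
        by (simp add: power2_eq_square algebra_simps)
      finally show ?thesis using 3 k km unfolding c e by simp
    qed
  qed
  have att: "\<exists>t. 0 \<le> t \<and> t \<le> 1 \<and> s * t - phi a t = ?c"
  proof -
    consider "s \<le> m" | "m < s" "s \<le> m + 2 * k" | "s > m + 2 * k" by linarith
    then show ?thesis
    proof cases
      case 1
      then show ?thesis unfolding c ph by (intro exI[of _ 0]) simp
    next
      case 2
      then show ?thesis unfolding c ph using k
        by (intro exI[of _ "(s - m) / (2 * k)"]) (simp add: field_simps power2_eq_square)
    next
      case 3
      then show ?thesis unfolding c ph using k km by (intro exI[of _ 1]) simp
    qed
  qed
  show ?thesis unfolding fenchel_conjugate_def
  proof (rule antisym)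
    show "(SUP t. ereal (s * t) - psi a t) \<le> ereal ?c"
    proof (rule SUP_least)
      fix t :: real
      show "ereal (s * t) - psi a t \<le> ereal ?c"
      proof (cases "t \<in> {0..1}")
        case True
        then have "ereal (s * t) - psi a t = ereal (s * t - phi a t)" by (simp add: psi_def)
        moreover have "s * t - phi a t \<le> ?c" using True by (intro ub) auto
        ultimately show ?thesis by (simp only: ereal_less_eq)
      next
        case False
        then have "ereal (s * t) - psi a t = - \<infinity>" by (simp add: psi_def del: atLeastAtMost_iff)
        then show ?thesis by (simp only: ereal_less_eq)
      qed
    qed
    obtain t where t: "0 \<le> t" "t \<le> 1" "s * t - phi a t = ?c" using att by blast
    have "ereal (s * t) - psi a t \<le> (SUP t. ereal (s * t) - psi a t)"
      by (rule SUP_upper) simp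
    moreover have "ereal (s * t) - psi a t = ereal (s * t - phi a t)"
      using t(1,2) by (simp add: psi_def)
    ultimately show "ereal ?c \<le> (SUP t. ereal (s * t) - psi a t)"
      by (simp only: t(3))
  qed
qed

definition F_mu ::
    "(real ^ 'n \<Rightarrow> real) \<Rightarrow> real ^ 'p ^ 'n \<Rightarrow> real ^ 'n \<Rightarrow> real \<Rightarrow> real ^ 'p \<Rightarrow> real" where
  "F_mu f A b \<mu> x = f (A *v x - b) + \<mu> / 2 * (norm x)\<^sup>2"

definition Theta ::
    "(real ^ 'n \<Rightarrow> real) \<Rightarrow> real ^ 'p ^ 'n \<Rightarrow> real ^ 'n \<Rightarrow> (real ^ 'p) set \<Rightarrow> real \<Rightarrow> real \<Rightarrow>
     real \<Rightarrow> real \<Rightarrow> real ^ 'p \<Rightarrow> ereal" where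
  "Theta f A b \<Omega> \<mu> a lam \<rho> x =
    ereal (F_mu f A b \<mu> x) + set_indicator \<Omega> x + ereal (lam * l1_norm x)
    - ereal (lam * inverse \<rho>) * (\<Sum>i\<in>UNIV. fenchel_conjugate (psi a) (\<rho> * \<bar>x $ i\<bar>))"

end

theory Submission imports Defs
begin

text \<open>Near \<open>xbar\<close> the concave part of the regularizer is invisible. The scalar penalty
  \<open>\<lambda>|t| - (\<lambda>/\<rho>) \<psi>\<^sup>*(\<rho>|t|)\<close> is \<open>\<lambda>|t|\<close> for small \<open>|t|\<close> and the constant \<open>\<lambda>/\<rho>\<close> for
  \<open>|t| > 2a/(\<rho>(a+1))\<close>. The nonzero entries of \<open>xbar\<close> lie strictly inside the flat region and
  the zero entries strictly inside the region of the absolute value, so on a ball around \<open>xbar\<close>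
  \<open>\<Theta>\<close> is a convex function restricted to \<open>\<Omega>\<close> plus \<open>(\<mu>/2)\<parallel>x\<parallel>\<^sup>2\<close>
  (\<open>Theta_locally_strongly_convex\<close>).

  For a function that is strongly convex on a neighbourhood, even a limiting subgradient \<open>v\<close>
  satisfies the subgradient inequality there with the gain \<open>(\<mu>/2)\<parallel>y - xbar\<parallel>\<^sup>2\<close>: regular
  subgradients satisfy it because it can be tested along segments
  (\<open>regular_subgradient_strongly_convex\<close>), and it survives the limit because the definition
  of the limiting subdifferential includes convergence of the function values
  (\<open>limiting_subgradient_strongly_convex\<close>). With \<open>v = 0\<close> this is quadratic growth, which gives
  local optimality at once and, inserted in the difference quotient, the bound
  \<open>d\<^sup>2\<Theta>(xbar|0)(\<zeta>) \<ge> \<mu>\<parallel>\<zeta>\<parallel>\<^sup>2\<close> (\<open>second_subderivative_ge_of_growth\<close>).\<close>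

text \<open>Convexity bounds the difference quotient of \<open>h\<close> on the segment from \<open>x\<close> to \<open>y\<close> by a
  quantity affine in the segment parameter, while the regular subgradient bounds its lower limit
  from below.\<close>

lemma regular_subgradient_strongly_convex:
  fixes h :: "'a::euclidean_space \<Rightarrow> ereal"
  assumes conv: "convex_on C q"
    and h: "\<And>z. z \<in> C \<Longrightarrow> h z = ereal (q z + \<kappa> / 2 * (norm z)\<^sup>2)"
    and C: "x \<in> C" "y \<in> C"
    and v: "v \<in> regular_subdifferential h x"
  shows "h x + ereal (v \<bullet> (y - x) + \<kappa> / 2 * (norm (y - x))\<^sup>2) \<le> h y"
proof (cases "y = x")
  case True
  then show ?thesis by simp
next
  case False
  define g where "g z = q z + \<kappa> / 2 * (norm z)\<^sup>2" for z
  define d where "d = y - x"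
  define m where "m t = (g y - g x - v \<bullet> d - \<kappa> / 2 * (1 - t) * (norm d)\<^sup>2) / norm d" for t :: real
  have d: "norm d > 0" using False by (simp add: d_def)
  have seg: "filterlim (\<lambda>t. x + t *\<^sub>R d) (at x) (at_right (0::real))"
    unfolding filterlim_at
  proof
    show "\<forall>\<^sub>F t in at_right 0. x + t *\<^sub>R d \<in> UNIV \<and> x + t *\<^sub>R d \<noteq> x"
      using d by (auto simp: eventually_at_filter)
    show "((\<lambda>t. x + t *\<^sub>R d) \<longlongrightarrow> x) (at_right 0)"
      by (auto intro!: tendsto_eq_intros)
  qed
  have quot: "(h (x + t *\<^sub>R d) - h x - ereal (v \<bullet> (x + t *\<^sub>R d - x))) /
        ereal (norm (x + t *\<^sub>R d - x)) \<le> ereal (m t)" if t: "0 < t" "t < 1" for t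
  proof -
    have z: "x + t *\<^sub>R d = (1 - t) *\<^sub>R x + t *\<^sub>R y" by (simp add: d_def algebra_simps)
    have zC: "x + t *\<^sub>R d \<in> C"
      unfolding z using convex_on_imp_convex[OF conv] C t by (intro convexD) auto
    have "q (x + t *\<^sub>R d) \<le> (1 - t) * q x + t * q y"
      unfolding z using convex_onD[OF conv _ _ C] t by auto
    \<comment> \<open>the squared norm satisfies the convexity inequality with a known defect, the source of the gain\<close>
    moreover have "(norm (x + t *\<^sub>R d))\<^sup>2 =
        (1 - t) * (norm x)\<^sup>2 + t * (norm y)\<^sup>2 - t * (1 - t) * (norm d)\<^sup>2"
      unfolding power2_norm_eq_inner d_def
      by (simp add: inner_simps inner_commute algebra_simps power2_eq_square)
    then have "\<kappa> / 2 * (norm (x + t *\<^sub>R d))\<^sup>2 =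
        \<kappa> / 2 * ((1 - t) * (norm x)\<^sup>2 + t * (norm y)\<^sup>2 - t * (1 - t) * (norm d)\<^sup>2)"
      by simp
    ultimately have "g (x + t *\<^sub>R d) - g x - t * (v \<bullet> d) \<le>
        t * (g y - g x - v \<bullet> d - \<kappa> / 2 * (1 - t) * (norm d)\<^sup>2)"
      unfolding g_def by (simp add: algebra_simps diff_divide_distrib)
    also have "\<dots> = m t * (t * norm d)"
      using d by (simp add: m_def)
    finally have "(g (x + t *\<^sub>R d) - g x - t * (v \<bullet> d)) / (t * norm d) \<le> m t"
      using d t by (simp add: pos_divide_le_eq)
    then show ?thesis
      using h[OF zC] h[OF C(1)] t d by (simp add: g_def)
  qed
  have "0 \<le> m 0"
  proof (rule field_le_epsilon)
    fix e :: real
    assume "e > 0"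
    have "0 \<le> Liminf (at x) (\<lambda>z. (h z - h x - ereal (v \<bullet> (z - x))) / ereal (norm (z - x)))"
      using v by (simp add: regular_subdifferential_def)
    then have "\<forall>\<^sub>F z in at x. ereal (- e) <
        (h z - h x - ereal (v \<bullet> (z - x))) / ereal (norm (z - x))"
      unfolding le_Liminf_iff using \<open>e > 0\<close> by (simp add: zero_ereal_def)
    then have "\<forall>\<^sub>F t in at_right 0. ereal (- e) <
        (h (x + t *\<^sub>R d) - h x - ereal (v \<bullet> (x + t *\<^sub>R d - x))) / ereal (norm (x + t *\<^sub>R d - x))"
      using seg by (rule eventually_compose_filterlim)
    moreover have "\<forall>\<^sub>F t in at_right (0::real). t \<in> {0<..<1}"
      by (rule eventually_at_right_real) simp
    ultimately have "\<forall>\<^sub>F t in at_right 0. - e \<le> m t"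
    proof eventually_elim
      case (elim t)
      then show ?case using less_le_trans[OF elim(1) quot] by simp
    qed
    moreover have "(m \<longlongrightarrow> m 0) (at_right 0)"
      unfolding m_def using d by (auto intro!: tendsto_eq_intros)
    ultimately have "- e \<le> m 0"
      using tendsto_lowerbound trivial_limit_at_right_real by blast
    then show "0 \<le> m 0 + e" by simp
  qed
  then have "g x + (v \<bullet> d + \<kappa> / 2 * (norm d)\<^sup>2) \<le> g y"
    using d by (simp add: m_def zero_le_divide_iff)
  then show ?thesis using h[OF C(1)] h[OF C(2)] by (simp add: g_def d_def)
qed

text \<open>The regular subgradient inequality holds along the approximating sequence, whose points
  lie in \<open>S\<close> because regular subgradients exist only where \<open>h\<close> is finite. Its left-hand side
  converges although \<open>h\<close> may be discontinuous at \<open>x\<close>, since \<open>h (X k) \<longlonglongrightarrow> h x\<close> is part of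
  the definition.\<close>

lemma limiting_subgradient_strongly_convex:
  fixes h :: "'a::euclidean_space \<Rightarrow> ereal"
  assumes U: "open U" "x \<in> U" and conv: "convex_on (S \<inter> U) q"
    and h: "\<And>z. z \<in> U \<Longrightarrow> h z = (if z \<in> S then ereal (q z + \<kappa> / 2 * (norm z)\<^sup>2) else \<infinity>)"
    and v: "v \<in> limiting_subdifferential h x" and y: "y \<in> U"
  shows "h x + ereal (v \<bullet> (y - x) + \<kappa> / 2 * (norm (y - x))\<^sup>2) \<le> h y"
proof (cases "y \<in> S")
  case False
  then show ?thesis using h[OF y] by simp
next
  case True
  obtain X V where X: "X \<longlonglongrightarrow> x" and hX: "(\<lambda>k. h (X k)) \<longlonglongrightarrow> h x"
    and V: "\<And>k. V k \<in> regular_subdifferential h (X k)" "V \<longlonglongrightarrow> v"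
    using v unfolding limiting_subdifferential_def by blast
  have "\<forall>\<^sub>F k in sequentially. X k \<in> U"
    using topological_tendstoD[OF X] U by blast
  then have "\<forall>\<^sub>F k in sequentially.
      h (X k) + ereal (V k \<bullet> (y - X k) + \<kappa> / 2 * (norm (y - X k))\<^sup>2) \<le> h y"
  proof eventually_elim
    case (elim k)
    have "X k \<in> S"
      using V(1)[of k] h[OF elim] by (auto simp: regular_subdifferential_def split: if_splits)
    then show ?case
      using elim True y h by (intro regular_subgradient_strongly_convex[OF conv _ _ _ V(1)]) auto
  qed
  moreover have "(\<lambda>k. h (X k) + ereal (V k \<bullet> (y - X k) + \<kappa> / 2 * (norm (y - X k))\<^sup>2))
      \<longlonglongrightarrow> h x + ereal (v \<bullet> (y - x) + \<kappa> / 2 * (norm (y - x))\<^sup>2)"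
    by (intro tendsto_add_ereal_general hX) (auto intro!: tendsto_intros X V(2))
  ultimately show ?thesis
    by (intro tendsto_upperbound) auto
qed

text \<open>In the difference quotient the factor \<open>\<tau>\<^sup>2/2\<close> cancels, so growth bounds it below by
  \<open>\<kappa>\<parallel>\<zeta>'\<parallel>\<^sup>2\<close>, which is continuous in \<open>\<zeta>'\<close>.\<close>

lemma second_subderivative_ge_of_growth:
  fixes h :: "'a::euclidean_space \<Rightarrow> ereal"
  assumes fin: "\<bar>h x\<bar> \<noteq> \<infinity>" and U: "open U" "x \<in> U"
    and growth: "\<And>y. y \<in> U \<Longrightarrow> h x + ereal (v \<bullet> (y - x) + \<kappa> / 2 * (norm (y - x))\<^sup>2) \<le> h y"
  shows "ereal (\<kappa> * (norm \<zeta>)\<^sup>2) \<le> second_subderivative h x v \<zeta>"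
proof -
  let ?F = "at_right (0::real) \<times>\<^sub>F nhds \<zeta>"
  obtain hx where hx: "h x = ereal hx" using fin by auto
  have fst0: "(fst \<longlongrightarrow> 0) ?F"
    by (rule filterlim_mono[OF filterlim_fst _ order_refl]) (simp add: at_within_le_nhds)
  have snd0: "(snd \<longlongrightarrow> \<zeta>) ?F"
    by (rule filterlim_snd)
  have "((\<lambda>p. x + fst p *\<^sub>R snd p) \<longlongrightarrow> x + 0 *\<^sub>R \<zeta>) ?F"
    by (intro tendsto_intros fst0 snd0)
  then have inU: "\<forall>\<^sub>F p in ?F. x + fst p *\<^sub>R snd p \<in> U"
    using topological_tendstoD U by force
  have pos: "\<forall>\<^sub>F p in ?F. fst p > 0"
    by (rule eventually_compose_filterlim[OF eventually_at_right_less filterlim_fst])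
  have lim: "((\<lambda>p. ereal (\<kappa> * (norm (snd p))\<^sup>2)) \<longlongrightarrow> ereal (\<kappa> * (norm \<zeta>)\<^sup>2)) ?F"
    by (auto intro!: tendsto_intros snd0)
  have "ereal (\<kappa> * (norm \<zeta>)\<^sup>2) = Liminf ?F (\<lambda>p. ereal (\<kappa> * (norm (snd p))\<^sup>2))"
    using lim by (intro lim_imp_Liminf[symmetric]) (auto simp: prod_filter_eq_bot)
  also have "\<dots> \<le> second_subderivative h x v \<zeta>"
    unfolding second_subderivative_def
  proof (rule Liminf_mono)
    show "\<forall>\<^sub>F p in ?F. ereal (\<kappa> * (norm (snd p))\<^sup>2) \<le> (case p of (\<tau>, \<zeta>') \<Rightarrow>
        (h (x + \<tau> *\<^sub>R \<zeta>') - h x - ereal (\<tau> * (v \<bullet> \<zeta>'))) / ereal (1/2 * \<tau>\<^sup>2))"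
      using inU pos
    proof eventually_elim
      case (elim p)
      obtain \<tau> \<zeta>' where p: "p = (\<tau>, \<zeta>')" by force
      have \<tau>: "\<tau> > 0" using elim p by simp
      have g: "ereal (hx + (\<tau> * (v \<bullet> \<zeta>') + \<kappa> / 2 * (\<tau> * norm \<zeta>')\<^sup>2)) \<le> h (x + \<tau> *\<^sub>R \<zeta>')"
        using growth[of "x + \<tau> *\<^sub>R \<zeta>'"] elim p \<tau> hx by simp
      have "ereal (\<kappa> * (norm \<zeta>')\<^sup>2) \<le>
          (h (x + \<tau> *\<^sub>R \<zeta>') - h x - ereal (\<tau> * (v \<bullet> \<zeta>'))) / ereal (1/2 * \<tau>\<^sup>2)"
      proof (cases "h (x + \<tau> *\<^sub>R \<zeta>')")
        case (real r)
        then have "hx + (\<tau> * (v \<bullet> \<zeta>') + \<kappa> / 2 * (\<tau> * norm \<zeta>')\<^sup>2) \<le> r" using g by simp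
        then have "\<kappa> * (norm \<zeta>')\<^sup>2 \<le> (r - hx - \<tau> * (v \<bullet> \<zeta>')) / (1/2 * \<tau>\<^sup>2)"
          using \<tau> by (simp add: pos_le_divide_eq power_mult_distrib algebra_simps)
        then show ?thesis using real hx \<tau> by simp
      next
        case PInf
        then show ?thesis using hx \<tau> by simp
      next
        case MInf
        then show ?thesis using g by simp
      qed
      then show ?case by (simp add: p)
    qed
  qed
  finally show ?thesis .
qed

text \<open>Subtracting \<open>\<lambda>/\<rho>\<close> times these two branches of \<open>\<psi>\<^sup>*\<close> from \<open>\<lambda>|t|\<close> leaves \<open>\<lambda>|t|\<close> and
  the constant \<open>\<lambda>/\<rho>\<close>; the quadratic branch between them is what would destroy convexity.\<close>

lemma fenchel_conjugate_psi_small: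
  assumes "a > 1" and "\<rho> > 0" and "\<bar>t\<bar> < 2 / (\<rho> * (a + 1))"
  shows "fenchel_conjugate (psi a) (\<rho> * \<bar>t\<bar>) = 0"
proof -
  have "\<bar>t\<bar> * (\<rho> * (a + 1)) < 2"
    using assms by (subst pos_less_divide_eq[symmetric]) auto
  then have "\<rho> * \<bar>t\<bar> \<le> 2 / (a + 1)" using assms by (simp add: pos_le_divide_eq mult_ac)
  then show ?thesis by (simp add: fenchel_conjugate_psi[OF assms(1)])
qed

lemma fenchel_conjugate_psi_large:
  assumes "a > 1" and "\<rho> > 0" and "\<bar>t\<bar> > 2 * a / (\<rho> * (a + 1))"
  shows "fenchel_conjugate (psi a) (\<rho> * \<bar>t\<bar>) = ereal (\<rho> * \<bar>t\<bar> - 1)"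
proof -
  have "2 * a < \<bar>t\<bar> * (\<rho> * (a + 1))"
    using assms by (subst pos_divide_less_eq[symmetric]) auto
  then have "\<rho> * \<bar>t\<bar> > 2 * a / (a + 1)" using assms by (simp add: pos_divide_less_eq mult_ac)
  \<comment> \<open>the last branch is selected only after the first one is excluded\<close>
  moreover have "2 * a / (a + 1) \<ge> 2 / (a + 1)"
    using assms by (intro divide_right_mono) auto
  ultimately show ?thesis by (simp add: fenchel_conjugate_psi[OF assms(1)])
qed

text \<open>Each coordinate falls on one side of the gap: an entry that vanishes at \<open>xbar\<close> stays below
  the first breakpoint of \<open>\<psi>\<^sup>*\<close> on a small ball and contributes \<open>\<lambda>|x\<^sub>i|\<close>, any other entry stays
  above the second one and contributes \<open>\<lambda>/\<rho>\<close>.\<close>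

lemma Theta_locally_strongly_convex:
  fixes f :: "real ^ 'n \<Rightarrow> real" and A :: "real ^ 'p ^ 'n" and b :: "real ^ 'n"
    and \<Omega> :: "(real ^ 'p) set" and xbar :: "real ^ 'p"
  assumes f: "convex_on UNIV f" and a: "a > 1" and lam: "lam \<ge> 0" and \<rho>: "\<rho> > 0"
    and gap: "min_abs_nonzero xbar > ereal (2 * a / (\<rho> * (a + 1)))"
  obtains q r where "convex_on UNIV q" and "r > 0"
    and "\<And>x. x \<in> ball xbar r \<Longrightarrow> Theta f A b \<Omega> \<mu> a lam \<rho> x =
      (if x \<in> \<Omega> then ereal (q x + \<mu> / 2 * (norm x)\<^sup>2) else \<infinity>)"
proof -
  define Z where "Z = {i. xbar $ i = 0}"
  define q where "q x = f (A *v x - b) + (lam * (\<Sum>i\<in>Z. \<bar>x $ i\<bar>) +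
    (\<Sum>i\<in>-Z. lam / \<rho>))" for x :: "real ^ 'p"
  have "convex_on UNIV (\<lambda>x. f (A *v x - b))"
  proof (rule convex_onI)
    fix t x y
    assume t: "0 < (t::real)" "t < 1"
    have "A *v ((1 - t) *\<^sub>R x + t *\<^sub>R y) - b = (1 - t) *\<^sub>R (A *v x - b) + t *\<^sub>R (A *v y - b)"
      by (simp add: matrix_vector_right_distrib vector_scaleR_matrix_ac matrix_vector_mult_scaleR
          algebra_simps)
    then show "f (A *v ((1 - t) *\<^sub>R x + t *\<^sub>R y) - b)
        \<le> (1 - t) * f (A *v x - b) + t * f (A *v y - b)"
      using convex_onD[OF f, of t "A *v x - b" "A *v y - b"] t by simp
  qed simp
  moreover have "convex_on UNIV (\<lambda>x :: real ^ 'p. \<Sum>i\<in>Z. \<bar>x $ i\<bar>)"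
  proof (rule convex_onI)
    fix t and x y :: "real ^ 'p"
    assume t: "0 < (t::real)" "t < 1"
    have "\<bar>((1 - t) *\<^sub>R x + t *\<^sub>R y) $ i\<bar> \<le> (1 - t) * \<bar>x $ i\<bar> + t * \<bar>y $ i\<bar>" for i
      using abs_triangle_ineq[of "(1 - t) * x $ i" "t * y $ i"] t by (simp add: abs_mult)
    then show "(\<Sum>i\<in>Z. \<bar>((1 - t) *\<^sub>R x + t *\<^sub>R y) $ i\<bar>)
        \<le> (1 - t) * (\<Sum>i\<in>Z. \<bar>x $ i\<bar>) + t * (\<Sum>i\<in>Z. \<bar>y $ i\<bar>)"
      by (simp add: sum_distrib_left sum.distrib[symmetric] sum_mono)
  qed simp
  ultimately have convq: "convex_on UNIV q"
    unfolding q_def using lam by (intro convex_on_add convex_on_cmul) (auto simp: convex_on_const)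
  have "\<forall>\<^sub>F x in nhds xbar. \<forall>i. if i \<in> Z then \<bar>x $ i\<bar> < 2 / (\<rho> * (a + 1))
      else \<bar>x $ i\<bar> > 2 * a / (\<rho> * (a + 1))"
  proof (rule eventually_all_finite)
    fix i
    have lim: "((\<lambda>x. \<bar>x $ i\<bar>) \<longlongrightarrow> \<bar>xbar $ i\<bar>) (nhds xbar)"
      by (intro tendsto_intros filterlim_ident)
    show "\<forall>\<^sub>F x in nhds xbar. if i \<in> Z then \<bar>x $ i\<bar> < 2 / (\<rho> * (a + 1))
      else \<bar>x $ i\<bar> > 2 * a / (\<rho> * (a + 1))"
    proof (cases "i \<in> Z")
      case True
      then have "\<bar>xbar $ i\<bar> < 2 / (\<rho> * (a + 1))" using a \<rho> by (simp add: Z_def)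
      then show ?thesis using True order_tendstoD(2)[OF lim] by simp
    next
      case False
      then have "min_abs_nonzero xbar \<le> ereal \<bar>xbar $ i\<bar>"
        unfolding min_abs_nonzero_def by (intro INF_lower) (simp add: Z_def)
      from less_le_trans[OF gap this] have "\<bar>xbar $ i\<bar> > 2 * a / (\<rho> * (a + 1))"
        by simp
      then show ?thesis using False order_tendstoD(1)[OF lim] by simp
    qed
  qed
  then obtain r where r: "r > 0" and near: "\<And>x i. x \<in> ball xbar r \<Longrightarrow>
      if i \<in> Z then \<bar>x $ i\<bar> < 2 / (\<rho> * (a + 1)) else \<bar>x $ i\<bar> > 2 * a / (\<rho> * (a + 1))"
    unfolding eventually_nhds_metric by (metis mem_ball dist_commute)
  have "Theta f A b \<Omega> \<mu> a lam \<rho> x = (if x \<in> \<Omega> then ereal (q x + \<mu> / 2 * (norm x)\<^sup>2) else \<infinity>)"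
    if x: "x \<in> ball xbar r" for x
  proof -
    have "fenchel_conjugate (psi a) (\<rho> * \<bar>x $ i\<bar>) =
        ereal (if i \<in> Z then 0 else \<rho> * \<bar>x $ i\<bar> - 1)" for i
      using near[OF x, of i] fenchel_conjugate_psi_small[OF a \<rho>] fenchel_conjugate_psi_large[OF a \<rho>]
      by (auto simp: zero_ereal_def split: if_splits)
    then have conj: "(\<Sum>i\<in>UNIV. fenchel_conjugate (psi a) (\<rho> * \<bar>x $ i\<bar>)) =
        ereal (\<Sum>i\<in>UNIV. if i \<in> Z then 0 else \<rho> * \<bar>x $ i\<bar> - 1)"
      by simp
    have "lam * l1_norm x - lam * inverse \<rho> * (\<Sum>i\<in>UNIV. if i \<in> Z then 0 else \<rho> * \<bar>x $ i\<bar> - 1)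
        = (\<Sum>i\<in>UNIV. if i \<in> Z then lam * \<bar>x $ i\<bar> else lam / \<rho>)"
      unfolding l1_norm_def sum_distrib_left sum_subtractf[symmetric]
      using \<rho> by (intro sum.cong) (auto simp: field_simps)
    also have "\<dots> = lam * (\<Sum>i\<in>Z. \<bar>x $ i\<bar>) + (\<Sum>i\<in>-Z. lam / \<rho>)"
      by (simp only: sum.If_cases[OF finite] sum_distrib_left) simp
    finally have "lam * l1_norm x -
        lam * inverse \<rho> * (\<Sum>i\<in>UNIV. if i \<in> Z then 0 else \<rho> * \<bar>x $ i\<bar> - 1)
        = lam * (\<Sum>i\<in>Z. \<bar>x $ i\<bar>) + (\<Sum>i\<in>-Z. lam / \<rho>)" .
    then show ?thesis
      unfolding Theta_def conj set_indicator_def F_mu_def q_def by (auto simp: algebra_simps)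
  qed
  then show thesis using that convq r by blast
qed

theorem theorem4p2:
  fixes f :: "real ^ 'n \<Rightarrow> real" and A :: "real ^ 'p ^ 'n" and b :: "real ^ 'n"
    and \<Omega> :: "(real ^ 'p) set" and \<mu> a lam \<rho> :: real and xbar :: "real ^ 'p"
  assumes "\<And>y. f y \<ge> 0" and "convex_on UNIV f" and "piecewise_linear_quadratic f"
    and "\<Omega> \<noteq> {}" and "polyhedron \<Omega>"
    and "\<mu> > 0" and "a > 1" and "lam > 0" and "\<rho> > 0"
    and "0 \<in> limiting_subdifferential (Theta f A b \<Omega> \<mu> a lam \<rho>) xbar"
    and "min_abs_nonzero xbar > ereal (2 * a / (\<rho> * (a + 1)))"
  shows "(\<forall>\<zeta>. \<zeta> \<noteq> 0 \<longrightarrow> second_subderivative (Theta f A b \<Omega> \<mu> a lam \<rho>) xbar 0 \<zeta> > 0)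
    \<and> local_minimizer (Theta f A b \<Omega> \<mu> a lam \<rho>) xbar"
proof -
  let ?\<Theta> = "Theta f A b \<Omega> \<mu> a lam \<rho>"
  obtain q r where q: "convex_on UNIV q" and r: "r > 0"
    and \<Theta>: "\<And>x. x \<in> ball xbar r \<Longrightarrow> ?\<Theta> x =
      (if x \<in> \<Omega> then ereal (q x + \<mu> / 2 * (norm x)\<^sup>2) else \<infinity>)"
    using Theta_locally_strongly_convex[of f a lam \<rho> xbar A b \<Omega> \<mu>] assms by auto
  have U: "open (ball xbar r)" "xbar \<in> ball xbar r" using r by auto
  have "convex_on (\<Omega> \<inter> ball xbar r) q"
    using q by (rule convex_on_subset) (auto intro: convex_Int polyhedron_imp_convex assms)
  then have growth: "?\<Theta> xbar + ereal (0 \<bullet> (y - xbar) + \<mu> / 2 * (norm (y - xbar))\<^sup>2) \<le> ?\<Theta> y"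
    if "y \<in> ball xbar r" for y
    using limiting_subgradient_strongly_convex[OF U _ \<Theta> assms(10) that] by blast
  have fin: "\<bar>?\<Theta> xbar\<bar> \<noteq> \<infinity>"
    using assms(10) by (simp add: limiting_subdifferential_def)
  show ?thesis
  proof (intro conjI allI impI)
    fix \<zeta> :: "real ^ 'p"
    assume "\<zeta> \<noteq> 0"
    then have "0 < ereal (\<mu> * (norm \<zeta>)\<^sup>2)" using \<open>\<mu> > 0\<close> by simp
    also have "\<dots> \<le> second_subderivative ?\<Theta> xbar 0 \<zeta>"
      using second_subderivative_ge_of_growth[OF fin U growth] .
    finally show "second_subderivative ?\<Theta> xbar 0 \<zeta> > 0" .
  next
    have "?\<Theta> xbar \<le> ?\<Theta> y" if "y \<in> ball xbar r" for y
    proof -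
      have "?\<Theta> xbar \<le> ?\<Theta> xbar + ereal (0 \<bullet> (y - xbar) + \<mu> / 2 * (norm (y - xbar))\<^sup>2)"
        using \<open>\<mu> > 0\<close> by (intro ereal_le_add_self) simp
      then show ?thesis using growth[OF that] by (rule order_trans)
    qed
    then show "local_minimizer ?\<Theta> xbar"
      unfolding local_minimizer_def eventually_nhds using fin U by blast
  qed
qed

end
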